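(* Let $G$ be a finite simple graph, let $u$ be a leaf of $G$ (a vertex of degree one) and let $v$ be the neighbor of $u$. Then $Z^-(G-\{u,v\})=Z^-(G)$.
   Context: Skew zero forcing: initially some set of vertices is colored blue and the rest white; the rule is: if $w$ is the only white neighbor of any vertex $u$ (blue or white), then $u$ may color $w$ blue. A skew zero forcing set is an initial blue set from which repeated application can make all vertices blue; $Z^-(G)$ is the minimum cardinality of a skew zero forcing set. $G-S$ denotes the subgraph induced by $V(G)\setminus S$, and by convention $Z^-$ of the graph with no vertices is $0$. *)

theory Defs
  imports "Graph_Theory.Digraph_Component"
begin

text \<open>
  Finite simple graphs are the locale \<open>graph\<close> of \<open>Graph_Theory\<close>: finite symmetric digraphs without
  loops and without parallel arcs. An edge is thus a pair of opposite arcs, so the degree of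
  a vertex is its \<open>out_degree\<close>. The graph without vertices is allowed.
\<close>

definition neighbors :: "('a, 'b) pre_digraph \<Rightarrow> 'a \<Rightarrow> 'a set" where
  "neighbors G x = {y. x \<rightarrow>\<^bsub>G\<^esub> y}"

text \<open>
  The forcing vertex \<open>x\<close> may itself be blue or white; this is the difference from standard
  zero forcing.
\<close>

definition skew_force :: "('a, 'b) pre_digraph \<Rightarrow> 'a set \<Rightarrow> 'a set \<Rightarrow> bool" where
  "skew_force G B B' \<longleftrightarrow>
     (\<exists>x\<in>verts G. \<exists>w. neighbors G x - B = {w} \<and> B' = insert w B)"

definition skew_zero_forcing_set :: "('a, 'b) pre_digraph \<Rightarrow> 'a set \<Rightarrow> bool" where
  "skew_zero_forcing_set G B \<longleftrightarrow> B \<subseteq> verts G \<and> (skew_force G)\<^sup>*\<^sup>* B (verts G)"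

definition skew_zero_forcing_number :: "('a, 'b) pre_digraph \<Rightarrow> nat" where
  "skew_zero_forcing_number G = Min (card ` {B. skew_zero_forcing_set G B})"

text \<open>
  For a finite graph the minimum ranges over a finite nonempty set, and on the graph
  without vertices the definition agrees with the convention that its value is \<open>0\<close>.
\<close>

lemma finite_skew_zero_forcing_sets:
  assumes "finite (verts G)"
  shows "finite {B. skew_zero_forcing_set G B}"
  by (rule finite_subset[of _ "Pow (verts G)"])
     (auto simp: skew_zero_forcing_set_def assms)

lemma skew_zero_forcing_set_verts: "skew_zero_forcing_set G (verts G)"
  by (simp add: skew_zero_forcing_set_def)

lemma skew_zero_forcing_number_empty:
  assumes "verts G = {}"
  shows "skew_zero_forcing_number G = 0"
proof -
  have "{B. skew_zero_forcing_set G B} = {{}}"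
    using assms by (auto simp: skew_zero_forcing_set_def)
  then show ?thesis
    by (simp add: skew_zero_forcing_number_def)
qed

end

theory Submission
  imports Defs
begin

text \<open>
  A set is skew zero forcing iff it lies in no proper stalled set, that is, in no proper vertex set
  from which no force is possible. Stalled sets are closed under intersection.

  For a leaf \<open>u\<close> with neighbor \<open>v\<close>, proper stalled sets of \<open>G - {u, v}\<close> and of \<open>G\<close> are turned into
  each other. A forcing set of \<open>G - {u, v}\<close> forces \<open>G\<close>, since \<open>u\<close> forces \<open>v\<close> at the beginning and
  \<open>v\<close> forces \<open>u\<close> at the end. Conversely, let \<open>B\<close> be a forcing set of \<open>G\<close>. If \<open>u \<notin> B\<close>, then
  \<open>B - {u, v}\<close> forces \<open>G - {u, v}\<close>. If \<open>u \<in> B\<close>, then \<open>v\<close> may force one vertex \<open>w\<close> other than \<open>u\<close>, and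
  exchanging \<open>u\<close> for \<open>w\<close> compensates for this.
\<close>

definition skew_stalled :: "('a, 'b) pre_digraph \<Rightarrow> 'a set \<Rightarrow> bool" where
  "skew_stalled G C \<longleftrightarrow> (\<forall>x\<in>verts G. \<forall>w. neighbors G x - C \<noteq> {w})"

text \<open>The only neighbor of \<open>x\<close> outside \<open>C \<inter> D\<close> is outside
  \<open>C\<close> or outside \<open>D\<close>, and is then the only one outside that set.\<close>

lemma skew_stalled_Int:
  assumes "skew_stalled G C" and "skew_stalled G D"
  shows "skew_stalled G (C \<inter> D)"
  unfolding skew_stalled_def
proof (intro ballI allI notI)
  fix x w
  assume x: "x \<in> verts G" and w: "neighbors G x - (C \<inter> D) = {w}"
  then have "neighbors G x - C = {w} \<or> neighbors G x - D = {w}"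
    by blast
  with assms x show False
    by (auto simp: skew_stalled_def)
qed

text \<open>A first force leaving \<open>C\<close> would already be possible from \<open>C\<close>
  itself, since enlarging the blue set leaves its target the only white neighbor.\<close>

lemma skew_force_rtranclp_subset_stalled:
  assumes "(skew_force G)\<^sup>*\<^sup>* B D" and "B \<subseteq> C" and "skew_stalled G C"
  shows "D \<subseteq> C"
  using assms(1)
proof induction
  case base
  show ?case by fact
next
  case (step D E)
  then obtain x w where "x \<in> verts G" and w: "neighbors G x - D = {w}" and E: "E = insert w D"
    by (auto simp: skew_force_def)
  then have "neighbors G x - C \<noteq> {w}"
    using assms(3) by (simp add: skew_stalled_def)
  with w step.IH have "w \<in> C"
    by blast
  with E step.IH show ?case by simp
qed

lemma (in wf_digraph) neighbors_subset_verts: "neighbors G x \<subseteq> verts G"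
  by (auto simp: neighbors_def)

text \<open>Forcing greedily never gets stuck before \<open>verts G\<close>; induction on the number
  of white vertices.\<close>

lemma (in fin_digraph) skew_zero_forcing_setI:
  assumes "B \<subseteq> verts G"
    and "\<And>C. B \<subseteq> C \<Longrightarrow> C \<subset> verts G \<Longrightarrow> skew_stalled G C \<Longrightarrow> False"
  shows "skew_zero_forcing_set G B"
proof -
  have "(skew_force G)\<^sup>*\<^sup>* D (verts G)" if "B \<subseteq> D" "D \<subseteq> verts G" for D
    using that
  proof (induction "card (verts G - D)" arbitrary: D rule: less_induct)
    case less
    show ?case
    proof (cases "D = verts G")
      case False
      with less.prems assms(2) have "\<not> skew_stalled G D"
        by blast
      then obtain x w where x: "x \<in> verts G" and w: "neighbors G x - D = {w}"
        by (auto simp: skew_stalled_def)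
      have wv: "w \<in> verts G" "w \<notin> D"
        using w neighbors_subset_verts by blast+
      have "card (verts G - insert w D) < card (verts G - D)"
        by (rule psubset_card_mono) (use wv in auto)
      with less.hyps less.prems wv have "(skew_force G)\<^sup>*\<^sup>* (insert w D) (verts G)"
        by blast
      moreover have "skew_force G D (insert w D)"
        using x w by (auto simp: skew_force_def)
      ultimately show ?thesis
        by (rule converse_rtranclp_into_rtranclp[rotated])
    qed simp
  qed
  with assms(1) show ?thesis
    by (simp add: skew_zero_forcing_set_def)
qed

lemma skew_zero_forcing_set_not_stalled:
  assumes "skew_zero_forcing_set G B" and "B \<subseteq> C" and "C \<subset> verts G"
  shows "\<not> skew_stalled G C"
  using skew_force_rtranclp_subset_stalled[of G B "verts G" C] assms
  by (auto simp: skew_zero_forcing_set_def)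

lemma skew_zero_forcing_number_mono:
  assumes "finite (verts G)" and "finite (verts H)"
    and "\<And>B. skew_zero_forcing_set H B \<Longrightarrow>
      \<exists>B'. skew_zero_forcing_set G B' \<and> card B' \<le> card B"
  shows "skew_zero_forcing_number G \<le> skew_zero_forcing_number H"
proof -
  have "skew_zero_forcing_number H \<in> card ` {B. skew_zero_forcing_set H B}"
    unfolding skew_zero_forcing_number_def
    using finite_skew_zero_forcing_sets[OF assms(2)] skew_zero_forcing_set_verts
    by (intro Min_in) auto
  then obtain B where B: "skew_zero_forcing_set H B" "skew_zero_forcing_number H = card B"
    by auto
  then obtain B' where "skew_zero_forcing_set G B'" "card B' \<le> card B"
    using assms(3) by blast
  moreover from this have "skew_zero_forcing_number G \<le> card B'"
    unfolding skew_zero_forcing_number_def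
    using finite_skew_zero_forcing_sets[OF assms(1)] by (intro Min_le) auto
  ultimately show ?thesis
    using B by simp
qed

lemma neighbors_induce_subgraph:
  assumes "x \<in> S"
  shows "neighbors (G \<restriction> S) x = neighbors G x \<inter> S"
  using assms by (fastforce simp: neighbors_def arcs_ends_def arc_to_ends_def)

lemma (in graph) neighbors_out_degree_1:
  assumes "out_degree G u = 1" and "u \<rightarrow>\<^bsub>G\<^esub> v"
  shows "neighbors G u = {v}"
proof -
  obtain a where a: "out_arcs G u = {a}"
    using assms(1) by (auto simp: out_degree_def card_1_singleton_iff)
  have "y = head G a" if "u \<rightarrow>\<^bsub>G\<^esub> y" for y
  proof -
    from that obtain e where e: "e \<in> arcs G" "tail G e = u" "head G e = y"
      by (auto simp: arcs_ends_def arc_to_ends_def)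
    then have "e \<in> out_arcs G u"
      by simp
    with a e show ?thesis by auto
  qed
  with assms(2) show ?thesis
    by (auto simp: neighbors_def)
qed

theorem theorem3p20:
  fixes G :: "('a, 'b) pre_digraph" and u v :: 'a
  assumes "graph G"
    and "u \<in> verts G" and "out_degree G u = 1"
    and "u \<rightarrow>\<^bsub>G\<^esub> v"
  shows "skew_zero_forcing_number (G \<restriction> (verts G - {u, v})) = skew_zero_forcing_number G"
proof -
  interpret G: graph G by fact
  define S where "S = verts G - {u, v}"
  define H where "H = G \<restriction> S"
  interpret H: digraph H
    unfolding H_def S_def by (intro G.digraphI_induced G.induced_induce) auto
  have vH: "verts H = S"
    by (simp add: H_def)
  have v: "v \<in> verts G"
    using assms(4) by auto
  have uv: "u \<noteq> v"
    using assms(4) G.adj_not_same by blast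
  have sym: "y \<in> neighbors G x \<Longrightarrow> x \<in> neighbors G y" for x y
    using G.graph_symmetric by (simp add: neighbors_def)
  have Nu: "neighbors G u = {v}"
    by (rule G.neighbors_out_degree_1) fact+
  have u_Nv: "u \<in> neighbors G v"
    using sym Nu by blast
  have v_Nv: "v \<notin> neighbors G v"
    using G.adj_not_same by (auto simp: neighbors_def)
  have NH: "neighbors H x = neighbors G x - {u, v}" if "x \<in> S" for x
    using that G.neighbors_subset_verts[of x] neighbors_induce_subgraph[of x S G]
    unfolding H_def S_def by auto
  have u_N: "u \<notin> neighbors G x" if "x \<in> S" for x
    using that sym[of u x] Nu by (auto simp: S_def)
  have NGC: "neighbors G x - C = neighbors H x - C" if "x \<in> S" "v \<in> C" for x C
    using NH u_N that by blast
  \<comment> \<open>Once \<open>v\<close> is blue, \<open>u\<close> has no white neighbor and each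
    vertex of \<open>S\<close> has the same white neighbors in \<open>G\<close> and
    \<open>H\<close>, so only \<open>v\<close> needs a separate condition.\<close>
  have stalled_iff: "skew_stalled G C \<longleftrightarrow>
      skew_stalled H (C \<inter> S) \<and> (\<forall>w. neighbors G v - C \<noteq> {w})" if "v \<in> C" for C
  proof -
    have V: "verts G = insert u (insert v S)"
      using v assms(2) by (auto simp: S_def)
    have "neighbors H x - C \<inter> S = neighbors G x - C" if "x \<in> S" for x
      using NGC[OF that \<open>v \<in> C\<close>] H.neighbors_subset_verts[of x] vH by blast
    then show ?thesis
      using that Nu by (auto simp: skew_stalled_def V vH)
  qed

  have GH: "skew_zero_forcing_set G B" if B: "skew_zero_forcing_set H B" for B
  proof (rule G.skew_zero_forcing_setI)
    show "B \<subseteq> verts G"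
      using B by (auto simp: skew_zero_forcing_set_def vH S_def)
    fix C
    assume C: "B \<subseteq> C" "C \<subset> verts G" "skew_stalled G C"
    have "v \<in> C"
    proof (rule ccontr)
      assume "v \<notin> C"
      with Nu have "neighbors G u - C = {v}" by auto
      with C(3) assms(2) show False by (simp add: skew_stalled_def)
    qed
    with C(3) have st: "skew_stalled H (C \<inter> S)" and Nv: "neighbors G v - C \<noteq> {u}"
      by (simp_all add: stalled_iff)
    have "B \<subseteq> C \<inter> S"
      using B C(1) by (auto simp: skew_zero_forcing_set_def vH)
    \<comment> \<open>The stalled set \<open>C \<inter> S\<close> must be all of \<open>S\<close>,
      so only \<open>u\<close> can be missing from \<open>C\<close>, and \<open>v\<close> would
      force it.\<close>
    with B st have "\<not> C \<inter> S \<subset> verts H"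
      using skew_zero_forcing_set_not_stalled by blast
    then have "S \<subseteq> C"
      by (auto simp: vH)
    with C(2) \<open>v \<in> C\<close> have "u \<notin> C" "verts G - C = {u}"
      using assms(2) by (auto simp: S_def)
    with u_Nv G.neighbors_subset_verts[of v] have "neighbors G v - C = {u}"
      by blast
    with Nv show False by contradiction
  qed

  have HG: "\<exists>B'. skew_zero_forcing_set H B' \<and> card B' \<le> card B"
    if B: "skew_zero_forcing_set G B" for B
  proof -
    define B0 where "B0 = B - {u, v}"
    have BV: "B \<subseteq> verts G"
      using B by (simp add: skew_zero_forcing_set_def)
    then have finB: "finite B"
      using G.finite_verts by (rule finite_subset)
    have B0S: "B0 \<subseteq> verts H"
      using BV by (auto simp: B0_def vH S_def)
    show ?thesis
    \<comment> \<open>If \<open>B0\<close> fails, a stalled set \<open>C\<close> above it determines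
      the vertex \<open>w\<close> to exchange for \<open>u\<close>.\<close>
    proof (cases "skew_zero_forcing_set H B0")
      case True
      then show ?thesis
        using card_mono[OF finB, of B0] by (auto simp: B0_def)
    next
      case False
      \<comment> \<open>\<open>E\<close> contains the forcing set \<open>B\<close>, so a force is
        possible from it; as \<open>C\<close> is stalled in \<open>H\<close>, only \<open>v\<close>
        can perform it.\<close>
      have forced: "\<exists>w. neighbors G v - E = {w}"
        if "C \<subset> verts H" "skew_stalled H C" "B \<subseteq> E" "v \<in> E" "E \<inter> S = C" "E \<subseteq> verts G" for C E
      proof -
        have "E \<subset> verts G"
          using that by (auto simp: vH S_def)
        then have "\<not> skew_stalled G E"
          by (rule skew_zero_forcing_set_not_stalled[OF B that(3)])
        then show ?thesis
          using that(2,5) stalled_iff[OF that(4)] by simp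
      qed
      have forced_uv: "\<exists>w. neighbors G v - insert u (insert v C) = {w}"
        if "B0 \<subseteq> C" "C \<subset> verts H" "skew_stalled H C" for C
        by (rule forced[OF that(2,3)]) (use that v assms(2) in \<open>auto simp: B0_def vH S_def\<close>)
      obtain C where C: "B0 \<subseteq> C" "C \<subset> verts H" "skew_stalled H C"
        using H.skew_zero_forcing_setI[OF B0S] False by blast
      obtain w where w: "neighbors G v - insert u (insert v C) = {w}"
        using forced_uv[OF C] by blast
      have w': "w \<in> neighbors G v" "w \<noteq> u" "w \<noteq> v" "w \<notin> C"
        using equalityD2[OF w] by simp_all
      then have wS: "w \<in> S"
        using G.neighbors_subset_verts[of v] by (auto simp: S_def)
      \<comment> \<open>Otherwise \<open>insert v C\<close> would contain \<open>B\<close>, so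
        \<open>v\<close> would have a single neighbor outside it, yet both \<open>u\<close> and
        \<open>w\<close> are such neighbors.\<close>
      have "u \<in> B"
      proof (rule ccontr)
        assume "u \<notin> B"
        then have "\<exists>y. neighbors G v - insert v C = {y}"
          by (intro forced[OF C(2,3)]) (use C v in \<open>auto simp: B0_def vH S_def\<close>)
        then obtain y where y: "neighbors G v - insert v C = {y}" ..
        have "u \<in> neighbors G v - insert v C"
          using u_Nv uv C(2) by (auto simp: vH S_def)
        moreover have "w \<in> neighbors G v - insert v C"
          using w' by simp
        ultimately show False
          using \<open>w \<noteq> u\<close> unfolding y by simp
      qed
      have "skew_zero_forcing_set H (insert w B0)"
      proof (rule H.skew_zero_forcing_setI)
        show "insert w B0 \<subseteq> verts H"
          using wS B0S by (simp add: vH)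
        fix D
        assume D: "insert w B0 \<subseteq> D" "D \<subset> verts H" "skew_stalled H D"
        then obtain y where y: "neighbors G v - insert u (insert v D) = {y}"
          using forced_uv[of D] by auto
        \<comment> \<open>\<open>C \<inter> D\<close> is again a proper stalled set above
          \<open>B0\<close>, and fewer blue vertices leave \<open>v\<close> at least the white
          neighbors it has for \<open>C\<close> and for \<open>D\<close>.\<close>
        obtain z where z: "neighbors G v - insert u (insert v (C \<inter> D)) = {z}"
          using forced_uv[of "C \<inter> D"] skew_stalled_Int[OF C(3) D(3)] C(1,2) D(1) by blast
        \<comment> \<open>Both \<open>w\<close> and \<open>y\<close> must be the vertex \<open>z\<close>, but \<open>w \<in> D\<close> and \<open>y \<notin> D\<close>.\<close>
        have "w = z" "y = z"
          using w y z by blast+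
        with y D(1) show False by blast
      qed
      moreover have "card (insert w B0) \<le> card B"
      proof -
        have "card (insert w B0) \<le> Suc (card B0)"
          by (rule card_insert_le_m1) simp_all
        also have "card B0 < card B"
          using finB \<open>u \<in> B\<close> by (intro psubset_card_mono) (auto simp: B0_def)
        then have "Suc (card B0) \<le> card B" by simp
        finally show ?thesis .
      qed
      ultimately show ?thesis by blast
    qed
  qed

  have "skew_zero_forcing_number H = skew_zero_forcing_number G"
  proof (rule antisym)
    show "skew_zero_forcing_number H \<le> skew_zero_forcing_number G"
      using HG by (intro skew_zero_forcing_number_mono) simp_all
    show "skew_zero_forcing_number G \<le> skew_zero_forcing_number H"
      using GH by (intro skew_zero_forcing_number_mono) auto
  qed
  then show ?thesis
    by (simp add: H_def S_def)
qed

end
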